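(* For $n\ge 1$ let $a_n = |S_n^2(231,321)|$. Then $a_1=1$ and $a_{n+1} = 4\cdot 3^{n-1}$ for all $n\ge 1$.
   Context: A $3$-permutation of size $n$ is an ordered pair $(\sigma,\sigma')$ of permutations of $[n]=\{1,\dots,n\}$. A (classical) permutation $\tau\in S_n$ contains a pattern $\pi\in S_k$ if there are indices $c_1<\dots<c_k$ such that $\tau(c_1)\cdots\tau(c_k)$ is order-isomorphic to $\pi$, and avoids $\pi$ otherwise. A $3$-permutation $(\sigma,\sigma')$ avoids a pattern $\pi\in S_k$ if each of the three permutations $\sigma$, $\sigma'$, and $\sigma'\circ\sigma^{-1}$ (where $(\sigma'\circ\sigma^{-1})(i)=\sigma'(\sigma^{-1}(i))$) avoids $\pi$. $S_n^2(\pi_1,\dots,\pi_m)$ denotes the set of $3$-permutations of size $n$ avoiding each of $\pi_1,\dots,\pi_m$. Patterns are written in one-line notation. *)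

theory Defs
  imports "HOL-Combinatorics.Permutations"
begin

text \<open>
  A permutation of \<open>[n]\<close> is a function \<open>\<tau>\<close> with \<open>\<tau> permutes {1..n}\<close> (hence the identity outside
  \<open>{1..n}\<close>). A pattern is the list of its one-line notation. Positions in that list are numbered
  from 0, whereas the indices \<open>c i\<close> range over \<open>{1..n}\<close>.
\<close>

definition contains_pattern :: "nat \<Rightarrow> (nat \<Rightarrow> nat) \<Rightarrow> nat list \<Rightarrow> bool" where
  "contains_pattern n \<tau> \<pi> \<longleftrightarrow>
     (\<exists>c :: nat \<Rightarrow> nat.
        c ` {..<length \<pi>} \<subseteq> {1..n} \<and>
        strict_mono_on {..<length \<pi>} c \<and>
        (\<forall>i<length \<pi>. \<forall>j<length \<pi>. \<tau> (c i) < \<tau> (c j) \<longleftrightarrow> \<pi> ! i < \<pi> ! j))"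

definition avoids_pattern :: "nat \<Rightarrow> (nat \<Rightarrow> nat) \<Rightarrow> nat list \<Rightarrow> bool" where
  "avoids_pattern n \<tau> \<pi> \<longleftrightarrow> \<not> contains_pattern n \<tau> \<pi>"

definition three_permutations :: "nat \<Rightarrow> ((nat \<Rightarrow> nat) \<times> (nat \<Rightarrow> nat)) set" where
  "three_permutations n = {(\<sigma>, \<sigma>'). \<sigma> permutes {1..n} \<and> \<sigma>' permutes {1..n}}"

definition avoids_pattern3 ::
    "nat \<Rightarrow> (nat \<Rightarrow> nat) \<times> (nat \<Rightarrow> nat) \<Rightarrow> nat list \<Rightarrow> bool" where
  "avoids_pattern3 n = (\<lambda>(\<sigma>, \<sigma>') \<pi>.
     avoids_pattern n \<sigma> \<pi> \<and> avoids_pattern n \<sigma>' \<pi> \<and> avoids_pattern n (\<sigma>' \<circ> inv \<sigma>) \<pi>)"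

definition avoiding_three_permutations ::
    "nat \<Rightarrow> nat list set \<Rightarrow> ((nat \<Rightarrow> nat) \<times> (nat \<Rightarrow> nat)) set" where
  "avoiding_three_permutations n P =
     {s \<in> three_permutations n. \<forall>\<pi>\<in>P. avoids_pattern3 n s \<pi>}"

end

theory Submission
  imports Defs
begin

text \<open>
  Avoiding 231 and 321 means that every entry has at most one larger entry to its left; for a
  permutation \<open>\<tau>\<close> this is equivalent to \<open>\<tau> j \<ge> j - 1\<close> for all \<open>j\<close>. Such a \<open>\<tau>\<close> is determined by
  its set of drops, the positions with \<open>\<tau> j = j - 1\<close>, and every subset of \<open>{2..n}\<close> occurs. If
  \<open>\<sigma>\<close> and \<open>\<rho>\<close> satisfy the inequality, then \<open>\<rho> \<circ> \<sigma>\<close> violates it exactly when \<open>\<sigma>\<close> drops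
  at some \<open>j\<close> and \<open>\<rho>\<close> drops at \<open>j - 1\<close>. So the 3-permutations in question correspond to disjoint
  pairs of subsets of \<open>{2..n}\<close> and \<open>{3..n+1}\<close>: three choices for each of the \<open>n - 2\<close> common
  elements, two for \<open>2\<close> and two for \<open>n + 1\<close>.
\<close>

section \<open>Occurrences of patterns of length three\<close>

lemma contains_pattern_length_3:
  assumes "length \<pi> = 3"
  shows "contains_pattern n \<tau> \<pi> \<longleftrightarrow>
    (\<exists>x y z. 1 \<le> x \<and> x < y \<and> y < z \<and> z \<le> n \<and>
      (\<forall>i<3. \<forall>j<3. \<tau> ([x, y, z] ! i) < \<tau> ([x, y, z] ! j) \<longleftrightarrow> \<pi> ! i < \<pi> ! j))"
    (is "_ = ?R")
proof
  assume "contains_pattern n \<tau> \<pi>"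
  then obtain c where c: "c ` {..<3} \<subseteq> {1..n}" "strict_mono_on {..<3} c"
    and ord: "\<forall>i<3. \<forall>j<3. \<tau> (c i) < \<tau> (c j) \<longleftrightarrow> \<pi> ! i < \<pi> ! j"
    using assms by (auto simp: contains_pattern_def)
  have nth: "[c 0, c 1, c 2] ! i = c i" if "i < 3" for i
    using that by (auto simp: less_Suc_eq numeral_eq_Suc)
  have "1 \<le> c 0" "c 2 \<le> n"
    using c(1) by (auto simp: image_subset_iff)
  moreover have "c 0 < c 1" "c 1 < c 2"
    using c(2) by (auto simp: strict_mono_on_def)
  ultimately show ?R
    using ord nth by (intro exI[of _ "c 0"] exI[of _ "c 1"] exI[of _ "c 2"]) simp
next
  assume ?R
  then obtain x y z where xyz: "1 \<le> x" "x < y" "y < z" "z \<le> n"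
    and "\<forall>i<3. \<forall>j<3. \<tau> ([x, y, z] ! i) < \<tau> ([x, y, z] ! j) \<longleftrightarrow> \<pi> ! i < \<pi> ! j"
    by blast
  \<comment> \<open>The list \<open>[x, y, z]\<close>, read as a function of its index, is the
    witness for \<open>c\<close>.\<close>
  moreover have "(!) [x, y, z] ` {..<3} \<subseteq> {1..n}"
    using xyz by (auto simp: less_Suc_eq numeral_eq_Suc)
  moreover have "strict_mono_on {..<3} ((!) [x, y, z])"
    using xyz by (auto simp: strict_mono_on_def less_Suc_eq numeral_eq_Suc)
  ultimately show "contains_pattern n \<tau> \<pi>"
    unfolding contains_pattern_def assms by blast
qed

lemma contains_231_iff:
  "contains_pattern n \<tau> [2, 3, 1] \<longleftrightarrow>
    (\<exists>x y z. 1 \<le> x \<and> x < y \<and> y < z \<and> z \<le> n \<and> \<tau> z < \<tau> x \<and> \<tau> x < \<tau> y)"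
  by (subst contains_pattern_length_3, simp, intro iff_exI)
    (auto simp: numeral_eq_Suc All_less_Suc)

lemma contains_321_iff:
  "contains_pattern n \<tau> [3, 2, 1] \<longleftrightarrow>
    (\<exists>x y z. 1 \<le> x \<and> x < y \<and> y < z \<and> z \<le> n \<and> \<tau> z < \<tau> y \<and> \<tau> y < \<tau> x)"
  by (subst contains_pattern_length_3, simp, intro iff_exI)
    (auto simp: numeral_eq_Suc All_less_Suc)

section \<open>Permutations with drops of size at most one\<close>

definition bounded_drop_perms :: "nat \<Rightarrow> (nat \<Rightarrow> nat) set" where
  "bounded_drop_perms n = {\<tau>. \<tau> permutes {1..n} \<and> (\<forall>j. j \<le> \<tau> j + 1)}"

text \<open>With addition instead of \<open>j - 1\<close>, the fixed point 0 does not count as a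
  drop.\<close>

definition drops :: "(nat \<Rightarrow> nat) \<Rightarrow> nat set" where
  "drops \<tau> = {j. \<tau> j + 1 = j}"

text \<open>Both directions are pigeonhole arguments: the first compares the positions left of
  \<open>j\<close> with the values below \<open>\<tau> j\<close>, the second the positions of the
  values up to \<open>\<tau> z\<close> with the room that the bound leaves them.\<close>

lemma avoids_231_321_iff:
  assumes \<tau>: "\<tau> permutes {1..n}"
  shows "avoids_pattern n \<tau> [2, 3, 1] \<and> avoids_pattern n \<tau> [3, 2, 1] \<longleftrightarrow>
    \<tau> \<in> bounded_drop_perms n"
proof -
  have inj: "inj \<tau>"
    using \<tau> by (rule permutes_inj)
  \<comment> \<open>The patterns differ only in the order of the two larger entries, which
    injectivity keeps distinct, so that order can be forgotten.\<close>
  have "avoids_pattern n \<tau> [2, 3, 1] \<and> avoids_pattern n \<tau> [3, 2, 1] \<longleftrightarrow>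
    \<not> (\<exists>x y z. 1 \<le> x \<and> x < y \<and> y < z \<and> z \<le> n \<and> \<tau> z < \<tau> x \<and> \<tau> z < \<tau> y)"
    (is "_ \<longleftrightarrow> \<not> ?C")
  proof -
    have "\<tau> x < \<tau> y \<or> \<tau> y < \<tau> x" if "x < y" for x y
      using that injD[OF inj, of x y] by (metis nat_neq_iff)
    then show ?thesis
      unfolding avoids_pattern_def contains_231_iff contains_321_iff
      by (meson less_trans)
  qed
  also have "\<not> ?C \<longleftrightarrow> (\<forall>j. j \<le> \<tau> j + 1)"
  proof
    assume avoid: "\<not> ?C"
    show "\<forall>j. j \<le> \<tau> j + 1"
    proof (rule ccontr)
      assume "\<not> (\<forall>j. j \<le> \<tau> j + 1)"
      then obtain j where j: "\<tau> j + 1 < j"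
        by (auto simp: not_le)
      then have jn: "j \<in> {1..n}"
        using permutes_not_in[OF \<tau>, of j] by fastforce
      \<comment> \<open>Two elements of \<open>L\<close> together with \<open>j\<close> would form
        \<open>?C\<close>. So at least \<open>j - 2\<close> earlier positions carry values below
        \<open>\<tau> j\<close>, but only \<open>\<tau> j - 1\<close> such values exist.\<close>
      define L where "L = {x \<in> {1..<j}. \<tau> j < \<tau> x}"
      have "x = y" if "x \<in> L" "y \<in> L" for x y
        using that avoid jn unfolding L_def by (cases x y rule: linorder_cases) auto
      then have "card L \<le> 1"
        by (simp add: card_le_Suc0_iff_eq L_def)
      have "\<tau> ` ({1..<j} - L) \<subseteq> {1..<\<tau> j}"
      proof
        fix v assume "v \<in> \<tau> ` ({1..<j} - L)"
        then obtain x where "v = \<tau> x" "x \<in> {1..<j} - L"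
          by blast
        then have x: "v = \<tau> x" "1 \<le> x" "x < j" "\<tau> x \<le> \<tau> j"
          by (auto simp: L_def)
        have "\<tau> x \<noteq> \<tau> j"
          using x injD[OF inj, of x j] by auto
        moreover have "1 \<le> \<tau> x"
          using permutes_in_image[OF \<tau>, of x] x jn by simp
        ultimately show "v \<in> {1..<\<tau> j}"
          using x by simp
      qed
      then have "card ({1..<j} - L) \<le> \<tau> j - 1"
        using card_inj_on_le[of \<tau> "{1..<j} - L" "{1..<\<tau> j}"] inj
        by (auto intro: inj_on_subset)
      moreover have "card ({1..<j} - L) = j - 1 - card L"
        by (subst card_Diff_subset) (auto simp: L_def)
      moreover have "1 \<le> \<tau> j"
        using permutes_in_image[OF \<tau>, of j] jn by simp
      ultimately show False
        using \<open>card L \<le> 1\<close> j by linarith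
    qed
  next
    assume bound: "\<forall>j. j \<le> \<tau> j + 1"
    show "\<not> ?C"
    proof
      assume ?C
      then obtain x y z where xyz: "1 \<le> x" "x < y" "y < z" "z \<le> n" "\<tau> z < \<tau> x" "\<tau> z < \<tau> y"
        by blast
      \<comment> \<open>By the bound, values up to \<open>\<tau> z\<close> sit at positions up to
        \<open>\<tau> z + 1\<close>; \<open>x\<close> and \<open>y\<close> occupy two of these with
        larger values, leaving \<open>\<tau> z - 1\<close> places for \<open>\<tau> z\<close>
        values.\<close>
      have "inv \<tau> ` {1..\<tau> z} \<subseteq> {1..\<tau> z + 1} - {x, y}"
      proof
        fix p assume "p \<in> inv \<tau> ` {1..\<tau> z}"
        then obtain v where v: "p = inv \<tau> v" "1 \<le> v" "v \<le> \<tau> z"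
          by auto
        then have p: "\<tau> p = v"
          using permutes_inverses[OF \<tau>] by simp
        have "p \<noteq> 0"
          using p v(2) permutes_not_in[OF \<tau>, of 0] by (cases p) auto
        moreover have "p \<le> \<tau> z + 1"
          using bound p v by (metis add_le_mono1 le_trans)
        ultimately show "p \<in> {1..\<tau> z + 1} - {x, y}"
          using p v xyz by auto
      qed
      then have "card {1..\<tau> z} \<le> card ({1..\<tau> z + 1} - {x, y})"
        using permutes_inj[OF permutes_inv[OF \<tau>]]
        by (intro card_inj_on_le[of "inv \<tau>"]) (auto intro: inj_on_subset)
      moreover have "{x, y} \<subseteq> {1..\<tau> z + 1}"
        using xyz bound[rule_format, of z] by auto
      then have "card ({1..\<tau> z + 1} - {x, y}) = \<tau> z + 1 - 2"
        using xyz by (subst card_Diff_subset) auto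
      \<comment> \<open>At 0 the truncated difference \<open>\<tau> z + 1 - 2\<close> would give no
        contradiction.\<close>
      moreover have "\<tau> z \<noteq> 0"
        using permutes_in_image[OF \<tau>, of z] xyz by auto
      ultimately show False
        by simp
    qed
  qed
  finally show ?thesis
    using \<tau> by (simp add: bounded_drop_perms_def)
qed

text \<open>Each factor lowers its argument by at most 1, so the bound fails only where both lower
  it in succession; \<open>Suc\<close> turns a drop of \<open>\<rho>\<close> at \<open>j - 1\<close>
  into a condition on \<open>j\<close>.\<close>

lemma comp_mem_bounded_drop_perms_iff:
  assumes "\<sigma> \<in> bounded_drop_perms n" "\<rho> \<in> bounded_drop_perms n"
  shows "\<rho> \<circ> \<sigma> \<in> bounded_drop_perms n \<longleftrightarrow> drops \<sigma> \<inter> Suc ` drops \<rho> = {}"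
proof -
  have \<sigma>: "\<sigma> permutes {1..n}" "j \<le> \<sigma> j + 1" and \<rho>: "\<rho> permutes {1..n}" "j \<le> \<rho> j + 1" for j
    using assms by (auto simp: bounded_drop_perms_def)
  have "j \<le> \<rho> (\<sigma> j) + 1 \<longleftrightarrow> \<not> (\<sigma> j + 1 = j \<and> \<rho> (\<sigma> j) + 1 = \<sigma> j)" for j
    using \<sigma>(2)[of j] \<rho>(2)[of "\<sigma> j"] by linarith
  moreover have "\<sigma> j + 1 = j \<and> \<rho> (\<sigma> j) + 1 = \<sigma> j \<longleftrightarrow> j \<in> drops \<sigma> \<inter> Suc ` drops \<rho>" for j
    by (auto simp: drops_def image_iff)
  ultimately show ?thesis
    using permutes_compose[OF \<sigma>(1) \<rho>(1)] by (auto simp: bounded_drop_perms_def)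
qed

section \<open>Recursion and sets of drops\<close>

text \<open>The bound leaves only \<open>n\<close> and \<open>Suc n\<close> as values at
  \<open>Suc n\<close>; swapping these two values reduces the first case to the second.\<close>

lemma bounded_drop_perms_Suc:
  assumes "1 \<le> n"
  shows "bounded_drop_perms (Suc n) =
    bounded_drop_perms n \<union> (\<circ>) (transpose n (Suc n)) ` bounded_drop_perms n"
    (is "_ = ?A \<union> ?t ` ?A")
proof (intro equalityI subsetI)
  fix \<tau> assume "\<tau> \<in> bounded_drop_perms (Suc n)"
  then have \<tau>: "\<tau> permutes {1..Suc n}" and bound: "j \<le> \<tau> j + 1" for j
    by (auto simp: bounded_drop_perms_def)
  have "\<tau> (Suc n) \<in> {1..Suc n}"
    using permutes_in_image[OF \<tau>, of "Suc n"] by simp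
  with bound[of "Suc n"] consider "\<tau> (Suc n) = Suc n" | "\<tau> (Suc n) = n"
    by fastforce
  then show "\<tau> \<in> ?A \<union> ?t ` ?A"
  proof cases
    case 1
    then have "\<tau> permutes {1..n}"
      using permutes_superset[OF \<tau>, of "{1..n}"] by (auto simp: atLeastAtMostSuc_conv)
    then show ?thesis
      using bound by (simp add: bounded_drop_perms_def)
  next
    case 2
    define \<rho> where "\<rho> = transpose n (Suc n) \<circ> \<tau>"
    have "transpose n (Suc n) permutes {1..Suc n}"
      using assms by (auto intro: permutes_swap_id)
    then have "\<rho> permutes {1..Suc n}"
      unfolding \<rho>_def using \<tau> by (rule permutes_compose[rotated])
    moreover have "\<rho> (Suc n) = Suc n"
      using 2 by (simp add: \<rho>_def)
    ultimately have "\<rho> permutes {1..n}"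
      using permutes_superset[of \<rho> "{1..Suc n}" "{1..n}"] by (auto simp: atLeastAtMostSuc_conv)
    \<comment> \<open>The swap lowers only the value \<open>Suc n\<close>, to \<open>n\<close>,
      which is enough for every position up to \<open>Suc n\<close>.\<close>
    moreover have "j \<le> \<rho> j + 1" for j
    proof (cases "\<tau> j = Suc n")
      case True
      then have "j \<in> {1..Suc n}"
        using permutes_in_image[OF \<tau>, of j] by simp
      then show ?thesis
        using True by (simp add: \<rho>_def)
    next
      case False
      then have "\<tau> j \<le> \<rho> j"
        by (simp add: \<rho>_def transpose_def)
      then show ?thesis
        using bound[of j] by linarith
    qed
    ultimately have "\<rho> \<in> ?A"
      by (simp add: bounded_drop_perms_def)
    moreover have "\<tau> = transpose n (Suc n) \<circ> \<rho>"
      by (simp add: \<rho>_def fun_eq_iff)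
    ultimately show ?thesis
      by blast
  qed
next
  fix \<tau> assume "\<tau> \<in> ?A \<union> ?t ` ?A"
  then show "\<tau> \<in> bounded_drop_perms (Suc n)"
  proof
    assume "\<tau> \<in> ?A"
    then show ?thesis
      by (auto simp: bounded_drop_perms_def intro: permutes_subset)
  next
    assume "\<tau> \<in> ?t ` ?A"
    then obtain \<rho> where \<tau>: "\<tau> = transpose n (Suc n) \<circ> \<rho>"
      and \<rho>: "\<rho> permutes {1..n}" and bound: "j \<le> \<rho> j + 1" for j
      by (auto simp: bounded_drop_perms_def)
    have "transpose n (Suc n) permutes {1..Suc n}"
      using assms by (auto intro: permutes_swap_id)
    moreover have "\<rho> permutes {1..Suc n}"
      using \<rho> by (rule permutes_subset) auto
    ultimately have "\<tau> permutes {1..Suc n}"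
      unfolding \<tau> by (rule permutes_compose[rotated])
    \<comment> \<open>The only lowered value, \<open>Suc n\<close>, is taken by
      \<open>\<rho>\<close> at \<open>Suc n\<close> alone, where a drop of size one results.\<close>
    moreover have "j \<le> \<tau> j + 1" for j
    proof (cases "\<rho> j = Suc n")
      case True
      then have "j = Suc n"
        using permutes_in_image[OF \<rho>, of j] permutes_not_in[OF \<rho>, of j] by fastforce
      then show ?thesis
        using True by (simp add: \<tau>)
    next
      case False
      then have "\<rho> j \<le> \<tau> j"
        by (simp add: \<tau> transpose_def)
      then show ?thesis
        using bound[of j] by linarith
    qed
    ultimately show ?thesis
      by (simp add: bounded_drop_perms_def)
  qed
qed

text \<open>The fixed point \<open>Suc n\<close> becomes a drop. The position of the value
  \<open>n\<close> is at most \<open>n\<close>, so it is no drop before or after the swap.\<close>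

lemma drops_transpose_comp:
  assumes "\<tau> permutes {1..n}"
  shows "drops (transpose n (Suc n) \<circ> \<tau>) = insert (Suc n) (drops \<tau>)"
proof -
  have "transpose n (Suc n) (\<tau> j) + 1 = j \<longleftrightarrow> j = Suc n \<or> \<tau> j + 1 = j" for j
  proof (cases "j \<in> {1..n}")
    case True
    then have "\<tau> j \<in> {1..n}"
      using permutes_in_image[OF assms, of j] by simp
    then show ?thesis
      using True by (auto simp: transpose_def)
  next
    case False
    then have "\<tau> j = j"
      using permutes_not_in[OF assms] by blast
    then show ?thesis
      using False by (auto simp: transpose_def)
  qed
  then show ?thesis
    by (auto simp: drops_def)
qed

text \<open>By induction: the two pieces of the recursion yield the subsets without and with
  \<open>Suc n\<close>.\<close>

lemma bij_betw_drops:
  assumes "1 \<le> n"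
  shows "bij_betw drops (bounded_drop_perms n) (Pow {2..n})"
  using assms
proof (induction n rule: nat_induct_at_least)
  case base
  have "bounded_drop_perms 1 = {id}"
    by (auto simp: bounded_drop_perms_def)
  then show ?case
    by (simp add: bij_betw_def drops_def)
next
  case (Suc n)
  let ?t = "(\<circ>) (transpose n (Suc n))"
  have drops_t: "drops (?t \<tau>) = insert (Suc n) (drops \<tau>)" if "\<tau> \<in> bounded_drop_perms n" for \<tau>
    using that by (intro drops_transpose_comp) (simp add: bounded_drop_perms_def)
  have "bij_betw drops (?t ` bounded_drop_perms n) (insert (Suc n) ` Pow {2..n})"
    unfolding bij_betw_def
  proof
    have "\<tau> = \<tau>'" if *: "\<tau> \<in> bounded_drop_perms n" "\<tau>' \<in> bounded_drop_perms n"
      "insert (Suc n) (drops \<tau>) = insert (Suc n) (drops \<tau>')" for \<tau> \<tau>'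
    proof -
      \<comment> \<open>Neither set contains \<open>Suc n\<close>, so the inserted element can be
        cancelled.\<close>
      have "drops \<tau> \<subseteq> {2..n}" "drops \<tau>' \<subseteq> {2..n}"
        using * bij_betwE[OF Suc.IH] by blast+
      then have "drops \<tau> = drops \<tau>'"
        using *(3) by (metis Diff_insert_absorb Suc_n_not_le_n atLeastAtMost_iff insert_ident subsetD)
      then show ?thesis
        using * Suc.IH by (auto simp: bij_betw_def inj_on_def)
    qed
    then show "inj_on drops (?t ` bounded_drop_perms n)"
      using drops_t by (auto simp: inj_on_def)
    have "drops ` ?t ` bounded_drop_perms n = insert (Suc n) ` drops ` bounded_drop_perms n"
      using drops_t by (auto simp: image_image)
    then show "drops ` ?t ` bounded_drop_perms n = insert (Suc n) ` Pow {2..n}"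
      using Suc.IH by (simp add: bij_betw_def)
  qed
  moreover have "Pow {2..n} \<inter> insert (Suc n) ` Pow {2..n} = {}"
    by auto
  moreover have "{2..Suc n} = insert (Suc n) {2..n}"
    using Suc.hyps by (auto simp: atLeastAtMostSuc_conv)
  ultimately show ?case
    unfolding bounded_drop_perms_Suc[OF Suc.hyps]
    using bij_betw_combine[OF Suc.IH] by (simp add: Pow_insert)
qed

section \<open>Counting pairs of disjoint subsets\<close>

text \<open>A common element goes to \<open>S\<close>, to \<open>T\<close> or to neither; an element
  of only one set is taken or left.\<close>

lemma card_disjoint_subset_pairs:
  assumes "finite A" "finite B"
  shows "card {(S, T). S \<subseteq> A \<and> T \<subseteq> B \<and> S \<inter> T = {}} =
    3 ^ card (A \<inter> B) * 2 ^ card (A - B) * 2 ^ card (B - A)"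
proof -
  have "{(S, T). S \<subseteq> A \<and> T \<subseteq> B \<and> S \<inter> T = {}} = Sigma (Pow A) (\<lambda>S. Pow (B - S))"
    by auto
  then have "card {(S, T). S \<subseteq> A \<and> T \<subseteq> B \<and> S \<inter> T = {}} = (\<Sum>S\<in>Pow A. 2 ^ card (B - S))"
    using assms by (simp add: card_Pow)
  also have "\<dots> = 3 ^ card (A \<inter> B) * 2 ^ card (A - B) * 2 ^ card (B - A)"
    using assms
  \<comment> \<open>\<open>B\<close> must vary: putting \<open>x\<close> into \<open>S\<close>
    removes it from \<open>B\<close>.\<close>
  proof (induction A arbitrary: B rule: finite_induct)
    case empty
    then show ?case by simp
  next
    case (insert x A)
    have "(\<Sum>S\<in>Pow (insert x A). 2 ^ card (B - S) :: nat) =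
      (\<Sum>S\<in>Pow A. 2 ^ card (B - S)) + (\<Sum>S\<in>insert x ` Pow A. 2 ^ card (B - S))"
      unfolding Pow_insert using insert.hyps by (intro sum.union_disjoint) auto
    also have "(\<Sum>S\<in>insert x ` Pow A. 2 ^ card (B - S) :: nat) =
      (\<Sum>S\<in>Pow A. 2 ^ card ((B - {x}) - S))"
      using insert.hyps
      by (subst sum.reindex) (auto simp: inj_on_def Diff_insert2[symmetric] intro!: sum.cong)
    finally have split: "(\<Sum>S\<in>Pow (insert x A). 2 ^ card (B - S) :: nat) =
      3 ^ card (A \<inter> B) * 2 ^ card (A - B) * 2 ^ card (B - A) +
      3 ^ card (A \<inter> (B - {x})) * 2 ^ card (A - (B - {x})) * 2 ^ card ((B - {x}) - A)"
      using insert.IH[of B] insert.IH[of "B - {x}"] insert.prems by simp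
    have drop: "A \<inter> (B - {x}) = A \<inter> B" "A - (B - {x}) = A - B" "B - {x} - A = B - insert x A"
      using insert.hyps by auto
    show ?case
    \<comment> \<open>If \<open>x\<close> is in \<open>B\<close>, the first summand is twice the
      second, giving the factor 3; otherwise the summands agree, giving the factor 2.\<close>
    proof (cases "x \<in> B")
      case True
      have "B - A = insert x (B - insert x A)"
        using True insert.hyps by auto
      then have "card (B - A) = Suc (card (B - insert x A))"
        using insert.prems by (metis DiffD2 card_insert_disjoint finite_Diff insertI1)
      then show ?thesis
        unfolding split drop \<open>card (B - A) = _\<close>
        using True insert.hyps by (simp add: Int_insert_left insert_Diff_if)
    next
      case False
      then have "B - insert x A = B - A"
        by auto
      then show ?thesis
        unfolding split drop using False insert.hyps by (simp add: Int_insert_left insert_Diff_if)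
    qed
  qed
  finally show ?thesis .
qed

section \<open>Encoding of 3-permutations and final count\<close>

text \<open>With \<open>\<rho> = \<sigma>' \<circ> inv \<sigma>\<close> as second coordinate, the
  condition on \<open>\<sigma>' = \<rho> \<circ> \<sigma>\<close> becomes disjointness of the sets
  of drops, once that of \<open>\<rho>\<close> is shifted by \<open>Suc\<close>.\<close>

lemma bij_betw_avoiding_three_permutations:
  assumes "1 \<le> n"
  shows "bij_betw (\<lambda>(\<sigma>, \<sigma>'). (drops \<sigma>, Suc ` drops (\<sigma>' \<circ> inv \<sigma>)))
    (avoiding_three_permutations n {[2, 3, 1], [3, 2, 1]})
    {(S, T). S \<subseteq> {2..n} \<and> T \<subseteq> {3..Suc n} \<and> S \<inter> T = {}}"
    (is "bij_betw _ ?X ?Y")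
proof -
  let ?A = "bounded_drop_perms n"
  let ?Z = "{(\<sigma>, \<rho>). \<sigma> \<in> ?A \<and> \<rho> \<in> ?A \<and> \<rho> \<circ> \<sigma> \<in> ?A}"
  have perm: "\<sigma> permutes {1..n}" if "\<sigma> \<in> ?A" for \<sigma>
    using that by (simp add: bounded_drop_perms_def)
  have X: "?X = {(\<sigma>, \<sigma>'). \<sigma> \<in> ?A \<and> \<sigma>' \<in> ?A \<and> \<sigma>' \<circ> inv \<sigma> \<in> ?A}"
  proof -
    have "(\<sigma>, \<sigma>') \<in> ?X \<longleftrightarrow> \<sigma> \<in> ?A \<and> \<sigma>' \<in> ?A \<and> \<sigma>' \<circ> inv \<sigma> \<in> ?A" for \<sigma> \<sigma>'
    proof (cases "\<sigma> permutes {1..n} \<and> \<sigma>' permutes {1..n}")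
      case True
      then have "\<sigma>' \<circ> inv \<sigma> permutes {1..n}"
        by (intro permutes_compose permutes_inv) auto
      then show ?thesis
        using True avoids_231_321_iff[of _ n]
        by (auto simp: avoiding_three_permutations_def three_permutations_def avoids_pattern3_def)
    next
      case False
      then show ?thesis
        by (auto simp: avoiding_three_permutations_def three_permutations_def dest: perm)
    qed
    then show ?thesis
      by auto
  qed
  have inv_cancel: "\<sigma>' \<circ> inv \<sigma> \<circ> \<sigma> = \<sigma>'" "\<rho> \<circ> \<sigma> \<circ> inv \<sigma> = \<rho>" if "\<sigma> \<in> ?A" for \<sigma> \<sigma>' \<rho> :: "nat \<Rightarrow> nat"
    using permutes_inverses[OF perm[OF that]] by (auto simp: fun_eq_iff)
  have "bij_betw (\<lambda>(\<sigma>, \<sigma>'). (\<sigma>, \<sigma>' \<circ> inv \<sigma>)) ?X ?Z"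
    by (rule bij_betw_byWitness[where f' = "\<lambda>(\<sigma>, \<rho>). (\<sigma>, \<rho> \<circ> \<sigma>)"]) (auto simp: X inv_cancel simp del: One_nat_def)
  moreover have "bij_betw (\<lambda>(\<sigma>, \<rho>). (drops \<sigma>, Suc ` drops \<rho>)) ?Z ?Y"
  proof -
    have D: "inj_on drops ?A" "drops ` ?A = Pow {2..n}"
      using bij_betw_drops[OF assms] by (auto simp: bij_betw_def)
    have "inj_on (\<lambda>(\<sigma>, \<rho>). (drops \<sigma>, Suc ` drops \<rho>)) ?Z"
      using D(1) by (auto simp: inj_on_def inj_image_eq_iff)
    moreover have "(\<lambda>(\<sigma>, \<rho>). (drops \<sigma>, Suc ` drops \<rho>)) ` ?Z = ?Y"
    proof (intro equalityI subsetI)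
      fix p assume "p \<in> (\<lambda>(\<sigma>, \<rho>). (drops \<sigma>, Suc ` drops \<rho>)) ` ?Z"
      then obtain \<sigma> \<rho> where *: "p = (drops \<sigma>, Suc ` drops \<rho>)" "\<sigma> \<in> ?A" "\<rho> \<in> ?A" "\<rho> \<circ> \<sigma> \<in> ?A"
        by auto
      then have "drops \<sigma> \<subseteq> {2..n}" "drops \<rho> \<subseteq> {2..n}"
        using D(2) by blast+
      moreover from this have "Suc ` drops \<rho> \<subseteq> {3..Suc n}"
        by fastforce
      ultimately show "p \<in> ?Y"
        using * comp_mem_bounded_drop_perms_iff[of \<sigma> n \<rho>] by simp
    next
      fix p assume "p \<in> ?Y"
      then obtain S T where ST: "p = (S, T)" "S \<subseteq> {2..n}" "T \<subseteq> {3..Suc n}" "S \<inter> T = {}"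
        by auto
      \<comment> \<open>Undoing the shift turns \<open>T\<close> into a set of drops
        \<open>R\<close> that some \<open>\<rho>\<close> realizes.\<close>
      have "{3..Suc n} = Suc ` {2..n}"
        by (simp add: image_Suc_atLeastAtMost numeral_eq_Suc)
      then obtain R where R: "R \<subseteq> {2..n}" "T = Suc ` R"
        using ST(3) by (metis subset_image_iff)
      obtain \<sigma> \<rho> where *: "\<sigma> \<in> ?A" "S = drops \<sigma>" "\<rho> \<in> ?A" "R = drops \<rho>"
        using D(2) ST(2) R(1) by (metis PowI imageE)
      then have "\<rho> \<circ> \<sigma> \<in> ?A"
        using comp_mem_bounded_drop_perms_iff[of \<sigma> n \<rho>] ST(4) R(2) by simp
      then show "p \<in> (\<lambda>(\<sigma>, \<rho>). (drops \<sigma>, Suc ` drops \<rho>)) ` ?Z"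
        using * ST(1) R(2) by (auto intro!: image_eqI[of _ _ "(\<sigma>, \<rho>)"])
    qed
    ultimately show ?thesis
      by (simp add: bij_betw_def)
  qed
  ultimately show ?thesis
    by (rule bij_betw_trans[THEN bij_betw_cong[THEN iffD1, rotated]]) auto
qed

theorem theorem3p4:
  fixes a :: "nat \<Rightarrow> nat"
  assumes "\<And>n. n \<ge> 1 \<Longrightarrow> a n = card (avoiding_three_permutations n {[2, 3, 1], [3, 2, 1]})"
  shows "a 1 = 1 \<and> (\<forall>n\<ge>1. a (n + 1) = 4 * 3 ^ (n - 1))"
proof -
  have a: "a n = 3 ^ card ({2..n} \<inter> {3..Suc n}) * 2 ^ card ({2..n} - {3..Suc n}) *
      2 ^ card ({3..Suc n} - {2..n})" if "n \<ge> 1" for n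
    using assms[OF that] bij_betw_same_card[OF bij_betw_avoiding_three_permutations[OF that]]
      card_disjoint_subset_pairs[of "{2..n}" "{3..Suc n}"] by simp
  \<comment> \<open>For size 1 both ground sets are empty.\<close>
  have "a 1 = 1"
    using a[of 1] by simp
  moreover have "a (n + 1) = 4 * 3 ^ (n - 1)" if "n \<ge> 1" for n
  proof -
    \<comment> \<open>There are \<open>n - 1\<close> common elements; the unshared \<open>2\<close>
      and \<open>n + 2\<close> contribute the factor 4.\<close>
    have "{2..n + 1} \<inter> {3..Suc (n + 1)} = {3..n + 1}"
      "{2..n + 1} - {3..Suc (n + 1)} = {2}" "{3..Suc (n + 1)} - {2..n + 1} = {n + 2}"
      using that by auto
    then show ?thesis
      using a[of "n + 1"] by simp
  qed
  ultimately show ?thesis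
    by blast
qed

end
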